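(* Let $p$ be an odd prime, $k\ge 1$ an integer, and $m\in \mathbb{Z}_{p^k}$. Let $t=v_p(m)$. Then the cardinality of the determinant fibre $$a_{p^k}(m)=\left|\{A\in M_2(\mathbb{Z}_{p^k}):\det(A)=m\}\right|$$ is given by $$a_{p^k}(m)=\begin{cases} p^{3k-2}(p^2-1), & t=0,\\ p^{3k-2-t}(p+1)(p^{t+1}-1), & 0<t<k,\\ p^{2k-1}(p^{k+1}+p^k-1), & t=k.\end{cases}$$
   Context: $\mathbb{Z}_{p^k}=\mathbb{Z}/p^k\mathbb{Z}$ is the residue class ring, and $M_2(\mathbb{Z}_{p^k})$ is the ring of $2\times 2$ matrices over it. The $p$-adic valuation $v_p$ on $\mathbb{Z}_{p^k}$ is defined as follows: for $m\neq 0$ with integer representative $a\in\{1,\dots,p^k-1\}$, $v_p(m)=\max\{t\ge 0: p^t\mid a\}$ (so $0\le v_p(m)\le k-1$), and $v_p(0)=k$. *)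

theory Defs
  imports "HOL-Analysis.Determinants" "Berlekamp_Zassenhaus.Finite_Field"
begin

text \<open>
  The ring of integers modulo \<open>p ^ k\<close> is \<open>'n mod_ring\<close> for an index type \<open>'n\<close> with
  \<open>CARD('n) = p ^ k\<close>.  The function \<open>to_int_mod_ring\<close> returns the representative of a
  residue class in \<open>{0..<p ^ k}\<close>.  The parameter \<open>k\<close> matters only for the convention that the
  valuation of zero is \<open>k\<close>.
\<close>

definition padic_val :: "nat \<Rightarrow> nat \<Rightarrow> 'n::finite mod_ring \<Rightarrow> nat" where
  "padic_val p k m =
     (if m = 0 then k else Max {t. int p ^ t dvd to_int_mod_ring m})"

lemma padic_val_less:
  fixes m :: "'n::finite mod_ring"
  assumes "prime p" "CARD('n) = p ^ k" "m \<noteq> 0"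
  shows "padic_val p k m < k"
proof -
  let ?a = "to_int_mod_ring m" and ?T = "{t. int p ^ t dvd to_int_mod_ring m}"
  have "?a \<in> {0..<int CARD('n)}"
    using range_to_int_mod_ring by blast
  moreover have "?a \<noteq> 0"
    using assms(3) by simp
  moreover have "int CARD('n) = int p ^ k"
    using assms(2) by simp
  ultimately have a: "0 < ?a" "?a < int p ^ k"
    unfolding atLeastLessThan_iff by linarith+
  have p: "1 < int p"
    using prime_gt_1_nat[OF assms(1)] by simp
  have less: "t < k" if "t \<in> ?T" for t
  proof -
    have "int p ^ t \<le> ?a"
      using that a(1) zdvd_imp_le by auto
    then have "int p ^ t < int p ^ k"
      using a(2) by linarith
    then show ?thesis
      using p power_less_imp_less_exp by blast
  qed
  then have "finite ?T"
    using finite_subset[of ?T "{..<k}"] by blast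
  moreover have "0 \<in> ?T"
    by simp
  ultimately have "Max ?T \<in> ?T"
    using Max_in by blast
  then show ?thesis
    using less assms(3) by (simp add: padic_val_def)
qed

end

theory Submission
  imports Defs
begin

text \<open>
  Fix the first row \<open>(a, b)\<close> and let \<open>g \<le> k\<close> be maximal such that \<open>p ^ g\<close> divides both entries.
  The additive map \<open>(c, d) \<mapsto> a d - b c\<close> has image \<open>p ^ g R\<close>, because for \<open>g < k\<close> one of the
  entries is \<open>p ^ g\<close> times a unit.  Hence the fibre over \<open>m\<close> has \<open>p ^ (k + g)\<close> elements if
  \<open>p ^ g\<close> divides \<open>m\<close> and is empty otherwise.  Summing over the
  \<open>p ^ (2 (k - g)) - p ^ (2 (k - g - 1))\<close> rows with a given \<open>g \<le> min t (k - 1)\<close>, and adding the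
  zero row if \<open>t = k\<close>, gives a geometric sum.
\<close>

section \<open>Fibres of additive maps and sums along decreasing chains\<close>

text \<open>Fibres over points of the image are translates of one another, hence equal in size, and
  they partition the domain.\<close>

lemma card_range_times_card_fibre:
  fixes f :: "'a::{finite,ab_group_add} \<Rightarrow> 'b::ab_group_add"
  assumes add: "\<And>x y. f (x + y) = f x + f y" and y: "y \<in> range f"
  shows "card (range f) * card {x. f x = y} = CARD('a)"
proof -
  obtain x0 where x0: "y = f x0"
    using y by blast
  have fib: "card {x. f x = z} = card {x. f x = y}" if "z \<in> range f" for z
  proof -
    obtain x1 where x1: "z = f x1"
      using \<open>z \<in> range f\<close> by blast
    \<comment> \<open>Additivity cancels \<open>f v\<close>; the translations by
      \<open>x0 - x1\<close> and by \<open>x1 - x0\<close> are both instances.\<close>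
    have *: "f (x + v) = f w \<longleftrightarrow> f x = f u" if "u + v = w" for x u v w
      using add[of x v] add[of u v] that by auto
    have "bij_betw (\<lambda>x. x + (x0 - x1)) {x. f x = z} {x. f x = y}"
      by (rule bij_betwI[where g = "\<lambda>x. x + (x1 - x0)"])
        (auto simp: x0 x1 *[of x1 "x0 - x1" x0] *[of x0 "x1 - x0" x1])
    then show ?thesis
      by (rule bij_betw_same_card)
  qed
  have "CARD('a) = (\<Sum>x\<in>(UNIV :: 'a set). 1)"
    by simp
  also have "\<dots> = (\<Sum>z\<in>range f. \<Sum>x | x \<in> UNIV \<and> f x = z. 1)"
    by (rule sum.image_gen) simp
  also have "\<dots> = (\<Sum>z\<in>range f. card {x. f x = y})"
    using fib by (intro sum.cong) auto
  finally show ?thesis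
    by simp
qed

text \<open>The differences \<open>D g - D (Suc g)\<close> peel \<open>D 0\<close> layer by layer
  down to \<open>D n\<close>. This serves to sort the first rows by the exact power of
  \<open>p\<close> dividing both entries.\<close>

lemma sum_decreasing_chain:
  fixes D :: "nat \<Rightarrow> 'a set" and F :: "'a \<Rightarrow> 'b::comm_monoid_add"
  assumes fin: "finite (D 0)" and dec: "\<And>g. D (Suc g) \<subseteq> D g"
  shows "sum F (D 0) = (\<Sum>g<n. sum F (D g - D (Suc g))) + sum F (D n)"
proof (induction n)
  case (Suc n)
  have "D n \<subseteq> D 0"
    using lift_Suc_antimono_le[of D 0 n] dec by auto
  then have "sum F (D n) = sum F (D n - D (Suc n)) + sum F (D (Suc n))"
    using fin dec by (intro sum.subset_diff) (auto intro: finite_subset)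
  then show ?case
    using Suc by (simp add: ac_simps)
qed simp

section \<open>Divisibility and units in the residue ring\<close>

lemma to_int_mod_ring_of_nat:
  "to_int_mod_ring (of_nat d :: 'n::nontriv mod_ring) = int d mod int CARD('n)"
  unfolding of_nat_of_int_mod_ring o_def by transfer simp

lemma of_int_to_int_mod_ring: "of_int (to_int_mod_ring x) = (x :: 'n::nontriv mod_ring)"
  by (simp add: of_int_of_int_mod_ring)

text \<open>As \<open>d\<close> divides the modulus, reducing a multiple of \<open>d\<close> leaves
  a multiple of \<open>d\<close>, so divisibility can be read off the representative.\<close>

lemma of_nat_dvd_mod_ring_iff:
  fixes x :: "'n::nontriv mod_ring"
  assumes "d dvd CARD('n)"
  shows "of_nat d dvd x \<longleftrightarrow> int d dvd to_int_mod_ring x"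
proof
  assume "of_nat d dvd x"
  then obtain y where "x = of_nat d * y" ..
  moreover have "int d dvd int CARD('n)"
    using assms by simp
  ultimately show "int d dvd to_int_mod_ring x"
    by (simp add: to_int_mod_ring_mult to_int_mod_ring_of_nat dvd_mod)
next
  assume "int d dvd to_int_mod_ring x"
  then obtain c where "to_int_mod_ring x = int d * c" ..
  then have "x = of_nat d * of_int c"
    by (metis of_int_mult of_int_of_nat_eq of_int_to_int_mod_ring)
  then show "of_nat d dvd x" ..
qed

text \<open>The multiples of \<open>d\<close> have the representatives \<open>d * i\<close> with
  \<open>i < e\<close>, and division by \<open>d\<close> recovers \<open>i\<close>.\<close>

lemma card_of_nat_dvd_mod_ring:
  assumes "CARD('n::nontriv) = d * e"
  shows "card {x :: 'n mod_ring. of_nat d dvd x} = e"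
proof -
  have d: "d > 0"
    using assms zero_less_card_finite[where 'a = 'n] by (cases d) auto
  have "bij_betw (\<lambda>i. of_int_mod_ring (int (d * i)) :: 'n mod_ring) {..<e}
    {x. of_nat d dvd x}"
  proof (rule bij_betwI[where g = "\<lambda>x. nat (to_int_mod_ring x div int d)"])
    have small: "int d * int i < int CARD('n)" if "i < e" for i
      using that assms d by (metis mult_less_cancel1 of_nat_less_iff of_nat_mult)
    show "(\<lambda>i. of_int_mod_ring (int (d * i)) :: 'n mod_ring) \<in> {..<e} \<rightarrow> {x. of_nat d dvd x}"
      using small assms by (auto simp: of_nat_dvd_mod_ring_iff)
    show "nat (to_int_mod_ring (of_int_mod_ring (int (d * i)) :: 'n mod_ring) div int d) = i"
      if "i \<in> {..<e}" for i
      using that small d by simp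
    have range: "0 \<le> to_int_mod_ring x \<and> to_int_mod_ring x < int d * int e" for x :: "'n mod_ring"
      using range_to_int_mod_ring[where 'a = 'n] assms by force
    show "(\<lambda>x :: 'n mod_ring. nat (to_int_mod_ring x div int d)) \<in> {x. of_nat d dvd x} \<rightarrow> {..<e}"
    proof
      fix x :: "'n mod_ring"
      have "int d * (to_int_mod_ring x div int d) < int d * int e"
        using range[of x] d pos_mod_sign[of "int d" "to_int_mod_ring x"]
          mult_div_mod_eq[of "int d" "to_int_mod_ring x"] by linarith
      then have "to_int_mod_ring x div int d < int e"
        using d by simp
      then show "nat (to_int_mod_ring x div int d) \<in> {..<e}"
        using range[of x] d by (simp add: nat_less_iff pos_imp_zdiv_nonneg_iff)
    qed
    show "of_int_mod_ring (int (d * nat (to_int_mod_ring x div int d))) = x"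
      if "x \<in> {x. of_nat d dvd x}" for x :: "'n mod_ring"
    proof -
      have "int d dvd to_int_mod_ring x"
        using that assms by (simp add: of_nat_dvd_mod_ring_iff)
      then show ?thesis
        using range[of x] d by (simp add: pos_imp_zdiv_nonneg_iff)
    qed
  qed
  then show ?thesis
    using bij_betw_same_card by force
qed

lemma card_power_dvd_mod_ring:
  assumes "CARD('n::nontriv) = p ^ k" "g \<le> k"
  shows "card {x :: 'n mod_ring. of_nat p ^ g dvd x} = p ^ (k - g)"
  using card_of_nat_dvd_mod_ring[where 'n = 'n, of "p ^ g" "p ^ (k - g)"] assms
  by (simp flip: power_add)

text \<open>The representative is coprime to \<open>p ^ k\<close>. In a Bezout identity for the two,
  the term with \<open>p ^ k\<close> vanishes in the ring and the other coefficient is an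
  inverse.\<close>

lemma is_unit_mod_ring_prime_power:
  fixes x :: "'n::nontriv mod_ring"
  assumes "prime p" "CARD('n) = p ^ k" "\<not> of_nat p dvd x"
  shows "x dvd 1"
proof -
  have "k \<noteq> 0"
    using assms(2) nontriv[where 'a = 'n] by (cases k) auto
  then have "\<not> int p dvd to_int_mod_ring x"
    using assms by (subst of_nat_dvd_mod_ring_iff[symmetric]) auto
  then have "coprime (int p ^ k) (to_int_mod_ring x)"
    using assms(1) by (simp add: prime_imp_coprime)
  then obtain u v where "u * int p ^ k + v * to_int_mod_ring x = 1"
    by (metis bezout_int coprime_imp_gcd_eq_1)
  then have "of_int (u * int p ^ k + v * to_int_mod_ring x) = (1 :: 'n mod_ring)"
    by simp
  moreover have "(of_nat p ^ k :: 'n mod_ring) = 0"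
    using of_nat_card_eq_0[where 'a = 'n] assms(2) by simp
  ultimately have "of_int v * x = 1"
    by (simp add: of_int_to_int_mod_ring)
  then show ?thesis
    by (metis dvd_triv_right)
qed

section \<open>Second rows for a fixed first row\<close>

text \<open>By \<open>max\<close> one entry is \<open>p ^ g\<close> times a unit, so it divides
  every multiple of \<open>p ^ g\<close>. The zero row never satisfies \<open>max\<close> and is
  treated separately.\<close>

lemma range_det_row:
  fixes a b :: "'n::nontriv mod_ring"
  assumes p: "prime p" and card: "CARD('n) = p ^ k"
    and dvd: "of_nat p ^ g dvd a" "of_nat p ^ g dvd b"
    and max: "\<not> (of_nat p ^ Suc g dvd a \<and> of_nat p ^ Suc g dvd b)"
  shows "range (\<lambda>(c, d). a * d - b * c) = {x. of_nat p ^ g dvd x}"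
proof (intro equalityI subsetI)
  fix x
  assume x: "x \<in> {x :: 'n mod_ring. of_nat p ^ g dvd x}"
  have *: "y dvd x" if "of_nat p ^ g dvd y" "\<not> of_nat p ^ Suc g dvd y" for y
  proof -
    obtain u where u: "y = of_nat p ^ g * u"
      using \<open>of_nat p ^ g dvd y\<close> ..
    then have "\<not> of_nat p dvd u"
      using that(2) by (metis mult_dvd_mono dvd_refl power_Suc2)
    then have "u dvd 1"
      using is_unit_mod_ring_prime_power p card by blast
    then have "y dvd of_nat p ^ g * 1"
      unfolding u by (intro mult_dvd_mono) simp_all
    then show ?thesis
      using x dvd_trans by auto
  qed
  from max consider "a dvd x" | "b dvd x"
    using * dvd by blast
  then show "x \<in> range (\<lambda>(c, d). a * d - b * c)"
  proof cases
    case 1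
    then obtain d where "x = a * d" ..
    then show ?thesis
      by (intro image_eqI[of _ _ "(0, d)"]) auto
  next
    case 2
    then obtain c where "x = b * c" ..
    then show ?thesis
      by (intro image_eqI[of _ _ "(- c, 0)"]) auto
  qed
qed (use dvd in auto)

text \<open>The image has \<open>p ^ (k - g)\<close> elements and there are
  \<open>p ^ (2 * k)\<close> pairs, which fixes the fibre size. Taking the image as a hypothesis
  lets the zero row, with \<open>g = k\<close>, be covered too.\<close>

lemma card_det_row:
  fixes a b m :: "'n::nontriv mod_ring"
  assumes p: "prime p" and card: "CARD('n) = p ^ k" and g: "g \<le> k"
    and range: "range (\<lambda>(c, d). a * d - b * c) = {x. of_nat p ^ g dvd x}"
  shows "card {(c, d). a * d - b * c = m} = (if of_nat p ^ g dvd m then p ^ (k + g) else 0)"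
proof (cases "of_nat p ^ g dvd m")
  case True
  let ?f = "\<lambda>(c, d). a * d - b * c"
  have "card (range ?f) * card {x. ?f x = m} = CARD('n mod_ring \<times> 'n mod_ring)"
    using True range by (intro card_range_times_card_fibre) (auto simp: algebra_simps)
  moreover have "card (range ?f) = p ^ (k - g)"
    unfolding range using card g by (rule card_power_dvd_mod_ring)
  moreover have "CARD('n mod_ring \<times> 'n mod_ring) = p ^ (k - g) * p ^ (k + g)"
    using card g by (simp flip: power_add)
  ultimately have "card {x. ?f x = m} = p ^ (k + g)"
    using prime_gt_0_nat[OF p] by simp
  then show ?thesis
    using True by (simp add: case_prod_unfold)
next
  case False
  then have "m \<notin> range (\<lambda>(c, d). a * d - b * c)"
    unfolding range by simp
  then have "{(c, d). a * d - b * c = m} = {}"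
    by auto
  then show ?thesis
    using False by (simp only: card.empty if_False)
qed

section \<open>Summation over the first rows\<close>

lemma card_det_fibre_mod_ring:
  fixes m :: "'n::nontriv mod_ring"
  assumes p: "prime p" and card: "CARD('n) = p ^ k"
  shows "card {A :: 'n mod_ring ^ 2 ^ 2. det A = m} =
    (\<Sum>g | g < k \<and> of_nat p ^ g dvd m. p ^ (k + g) * (p ^ (2 * (k - g)) - p ^ (2 * (k - Suc g)))) +
    (if m = 0 then p ^ (2 * k) else 0)"
proof -
  define B where "B = (\<lambda>(a, b). {(c, d). a * d - b * c = m})"
  \<comment> \<open>\<open>D 0\<close> consists of all first rows, and \<open>D k\<close> of the
    zero row alone, since \<open>p ^ k\<close> vanishes in the ring.\<close>
  define D where "D g = {x :: 'n mod_ring. of_nat p ^ g dvd x} \<times> {x :: 'n mod_ring. of_nat p ^ g dvd x}" for g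
  have card_D: "card (D g) = p ^ (2 * (k - g))" if "g \<le> k" for g
    unfolding D_def card_cartesian_product
    by (simp only: card_power_dvd_mod_ring[OF card that] mult_2 power_add)
  have dec: "D (Suc g) \<subseteq> D g" for g
    unfolding D_def by (auto intro: power_le_dvd)
  have zero: "(of_nat p ^ k :: 'n mod_ring) = 0"
    using of_nat_card_eq_0[where 'a = 'n] card by simp
  have level: "(\<Sum>x\<in>D g - D (Suc g). card (B x)) =
      (if of_nat p ^ g dvd m then p ^ (k + g) * (p ^ (2 * (k - g)) - p ^ (2 * (k - Suc g))) else 0)"
    if "g < k" for g
  proof -
    have "card (B x) = (if of_nat p ^ g dvd m then p ^ (k + g) else 0)"
      if x: "x \<in> D g - D (Suc g)" for x
    proof -
      obtain a b where ab: "x = (a, b)"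
        by fastforce
      have "range (\<lambda>(c, d). a * d - b * c) = {x. of_nat p ^ g dvd x}"
        using x unfolding ab D_def by (intro range_det_row[OF p card]) auto
      then show ?thesis
        using card_det_row[OF p card, of g a b m] \<open>g < k\<close> by (simp add: B_def ab)
    qed
    moreover have "card (D g - D (Suc g)) = p ^ (2 * (k - g)) - p ^ (2 * (k - Suc g))"
      using that by (subst card_Diff_subset[OF _ dec]) (simp_all add: card_D)
    ultimately show ?thesis
      by simp
  qed
  have "bij_betw (\<lambda>A. ((A $ 1 $ 1, A $ 1 $ 2), (A $ 2 $ 1, A $ 2 $ 2)))
    {A :: 'n mod_ring ^ 2 ^ 2. det A = m} (Sigma (D 0) B)"
    by (rule bij_betwI[where g = "\<lambda>((a, b), (c, d)). vector [vector [a, b], vector [c, d]]"])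
      (auto simp: B_def D_def det_2 vec_eq_iff forall_2 vector_2)
  then have "card {A :: 'n mod_ring ^ 2 ^ 2. det A = m} = card (Sigma (D 0) B)"
    by (rule bij_betw_same_card)
  also have "\<dots> = (\<Sum>x\<in>D 0. card (B x))"
    by (intro card_SigmaI) auto
  also have "\<dots> = (\<Sum>g<k. \<Sum>x\<in>D g - D (Suc g). card (B x)) + (\<Sum>x\<in>D k. card (B x))"
    by (intro sum_decreasing_chain dec) simp
  also have "(\<Sum>x\<in>D k. card (B x)) = (if m = 0 then p ^ (2 * k) else 0)"
  proof -
    have "D k = {(0, 0)}"
      unfolding D_def zero by auto
    moreover have "range (\<lambda>(c, d). 0 * d - 0 * c) = {x :: 'n mod_ring. of_nat p ^ k dvd x}"
      unfolding zero by auto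
    ultimately show ?thesis
      using card_det_row[OF p card order_refl, of 0 0 m] zero by (simp add: B_def mult_2)
  qed
  also have "(\<Sum>g<k. \<Sum>x\<in>D g - D (Suc g). card (B x)) = (\<Sum>g | g < k \<and> of_nat p ^ g dvd m.
      p ^ (k + g) * (p ^ (2 * (k - g)) - p ^ (2 * (k - Suc g))))"
    using sum.inter_filter[of "{..<k}", symmetric] by (simp add: level)
  finally show ?thesis .
qed

section \<open>The valuation and the closed form\<close>

lemma power_dvd_iff_le_padic_val:
  fixes m :: "'n::nontriv mod_ring"
  assumes p: "prime p" and card: "CARD('n) = p ^ k" and g: "g \<le> k"
  shows "of_nat p ^ g dvd m \<longleftrightarrow> g \<le> padic_val p k m"
proof (cases "m = 0")
  case True
  then show ?thesis
    using g by (simp add: padic_val_def)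
next
  case False
  let ?T = "{t. int p ^ t dvd to_int_mod_ring m}"
  have p1: "\<not> is_unit (int p)"
    using p by auto
  have "to_int_mod_ring m \<noteq> 0"
    using False by simp
  then have "finite ?T"
    using finite_divisor_powers[OF _ p1] by blast
  moreover have "0 \<in> ?T"
    by simp
  ultimately have Max: "Max ?T \<in> ?T" "\<And>t. t \<in> ?T \<Longrightarrow> t \<le> Max ?T"
    using Max_in[of ?T] by (blast, simp)
  have "of_nat p ^ g dvd m \<longleftrightarrow> g \<in> ?T"
    using of_nat_dvd_mod_ring_iff[of "p ^ g" m] card g by (simp add: le_imp_power_dvd)
  \<comment> \<open>\<open>?T\<close> is downward closed, so membership is comparison with its
    maximum.\<close>
  also have "\<dots> \<longleftrightarrow> g \<le> Max ?T"
    using Max by (auto intro: power_le_dvd)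
  finally show ?thesis
    using False by (simp add: padic_val_def)
qed

text \<open>Since \<open>k + g + 2 * (k - Suc g) = 3 * k - 2 - g\<close>, the terms form a geometric
  progression with ratio \<open>1 / p\<close>, summed by induction on \<open>t\<close>.\<close>

lemma sum_level_contributions:
  fixes p k t :: nat
  assumes "p > 0" "t < k"
  shows "(\<Sum>g\<le>t. p ^ (k + g) * (p ^ (2 * (k - g)) - p ^ (2 * (k - Suc g)))) =
    p ^ (3 * k - 2 - t) * (p + 1) * (p ^ (t + 1) - 1)"
proof -
  have eq: "p ^ (k + g) * (p ^ (2 * (k - g)) - p ^ (2 * (k - Suc g))) =
      p ^ (3 * k - 2 - g) * (p + 1) * (p - 1)" if "g < k" for g
  proof -
    have "p ^ (2 * (k - g)) = p ^ (2 * (k - Suc g)) * p ^ 2"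
      using that by (subst power_add[symmetric], intro arg_cong[where f = "power p"]) simp
    then have "p ^ (2 * (k - g)) - p ^ (2 * (k - Suc g)) = p ^ (2 * (k - Suc g)) * (p ^ 2 - 1)"
      by (simp add: diff_mult_distrib2)
    moreover have "p ^ (3 * k - 2 - g) = p ^ (k + g) * p ^ (2 * (k - Suc g))"
      using that by (subst power_add[symmetric], intro arg_cong[where f = "power p"]) simp
    moreover have "p ^ 2 - 1 = (p + 1) * (p - 1)"
      by (simp add: power2_eq_square algebra_simps)
    ultimately show ?thesis
      by (simp only: mult.assoc)
  qed
  show ?thesis
    using assms(2)
  proof (induction t)
    case 0
    then show ?case
      using eq[of 0] by simp
  next
    case (Suc t)
    \<comment> \<open>The exponent drops by one from \<open>t\<close> to \<open>Suc t\<close>, so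
      the earlier sum carries an extra factor \<open>p\<close> over \<open>?q\<close>.\<close>
    let ?q = "p ^ (3 * k - 2 - Suc t) * (p + 1)"
    have "3 * k - 2 - t = Suc (3 * k - 2 - Suc t)"
      using Suc.prems by simp
    then have pow: "p ^ (3 * k - 2 - t) * (p + 1) = ?q * p"
      by (simp only: power_Suc2 ac_simps)
    have "(\<Sum>g\<le>Suc t. p ^ (k + g) * (p ^ (2 * (k - g)) - p ^ (2 * (k - Suc g)))) =
        ?q * p * (p ^ (t + 1) - 1) + ?q * (p - 1)"
      unfolding sum.atMost_Suc eq[OF Suc.prems] using Suc.IH Suc.prems pow by simp
    also have "\<dots> = ?q * (p * (p ^ (t + 1) - 1) + (p - 1))"
      by (simp only: distrib_left mult.assoc)
    also have "p * (p ^ (t + 1) - 1) + (p - 1) = p ^ (Suc t + 1) - 1"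
      using assms(1) by (simp add: diff_mult_distrib2)
    finally show ?case .
  qed
qed

theorem theorem5p6:
  fixes p k t :: nat and m :: "'n::nontriv mod_ring"
  assumes "prime p" and "odd p" and "k \<ge> 1" and "CARD('n) = p ^ k"
    and "t = padic_val p k m"
  shows "card {A :: 'n mod_ring ^ 2 ^ 2. det A = m} =
    (if t = 0 then p ^ (3 * k - 2) * (p ^ 2 - 1)
     else if t < k then p ^ (3 * k - 2 - t) * (p + 1) * (p ^ (t + 1) - 1)
     else p ^ (2 * k - 1) * (p ^ (k + 1) + p ^ k - 1))"
proof -
  let ?term = "\<lambda>g. p ^ (k + g) * (p ^ (2 * (k - g)) - p ^ (2 * (k - Suc g)))"
  have p: "p > 0"
    using assms(1) by (rule prime_gt_0_nat)
  have dvd: "{g. g < k \<and> of_nat p ^ g dvd m} = {g. g < k \<and> g \<le> t}"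
    using power_dvd_iff_le_padic_val[OF assms(1,4), of _ m] assms(5) by auto
  have count: "card {A :: 'n mod_ring ^ 2 ^ 2. det A = m} =
      (\<Sum>g | g < k \<and> g \<le> t. ?term g) + (if m = 0 then p ^ (2 * k) else 0)"
    unfolding card_det_fibre_mod_ring[OF assms(1,4)] dvd ..
  show ?thesis
  proof (cases "m = 0")
    case True
    then have t: "t = k"
      using assms(5) by (simp add: padic_val_def)
    \<comment> \<open>Here \<open>t = k\<close>, but nonzero rows only reach level
      \<open>k - 1\<close>; the zero row supplies the summand \<open>p ^ (2 * k)\<close>.\<close>
    then have "{g. g < k \<and> g \<le> t} = {..k - 1}"
      using assms(3) by auto
    then have "card {A :: 'n mod_ring ^ 2 ^ 2. det A = m} =
        p ^ (3 * k - 2 - (k - 1)) * (p + 1) * (p ^ (k - 1 + 1) - 1) + p ^ (2 * k)"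
      using sum_level_contributions[OF p, of "k - 1" k] assms(3) count True by simp
    also have "3 * k - 2 - (k - 1) = 2 * k - 1"
      using assms(3) by simp
    also have "k - 1 + 1 = k"
      using assms(3) by simp
    also have "p ^ (2 * k) = p ^ (2 * k - 1) * p"
      using assms(3) by (simp flip: power_Suc2)
    also have "p ^ (2 * k - 1) * (p + 1) * (p ^ k - 1) + p ^ (2 * k - 1) * p =
        p ^ (2 * k - 1) * ((p + 1) * (p ^ k - 1) + p)"
      by (metis distrib_left mult.assoc)
    also have "(p + 1) * (p ^ k - 1) + p = p ^ (k + 1) + p ^ k - 1"
    proof -
      \<comment> \<open>Writing \<open>p ^ k\<close> as a successor removes the truncated
        subtractions.\<close>
      obtain q where "p ^ k = Suc q"
        using p by (metis gr0_implies_Suc zero_less_power)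
      then show ?thesis
        by (simp add: algebra_simps)
    qed
    finally show ?thesis
      using t assms(3) by simp
  next
    case False
    then have t: "t < k"
      using padic_val_less[OF assms(1,4)] assms(5) by simp
    then have "{g. g < k \<and> g \<le> t} = {..t}"
      by auto
    then have "card {A :: 'n mod_ring ^ 2 ^ 2. det A = m} =
        p ^ (3 * k - 2 - t) * (p + 1) * (p ^ (t + 1) - 1)"
      using sum_level_contributions[OF p t] count False by simp
    \<comment> \<open>The case \<open>t = 0\<close> is the general formula for \<open>t < k\<close>
      with this product rewritten.\<close>
    moreover have "(p + 1) * (p - 1) = p ^ 2 - 1"
      by (simp add: power2_eq_square algebra_simps)
    then have "p ^ (3 * k - 2 - t) * (p + 1) * (p ^ (t + 1) - 1) = p ^ (3 * k - 2) * (p ^ 2 - 1)"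
      if "t = 0"
      by (simp only: that mult.assoc) simp
    ultimately show ?thesis
      using t by presburger
  qed
qed

end
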